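(* Let $L\in\{2,3,4\}$, let $m_{\max}>0$ and $N_{\mathrm{th}}>0$ be real numbers, and let $\rho = N_{\mathrm{th}}/m_{\max}$ with $\rho>1$. Consider all choices of integers $2\le \Gamma_1<\Gamma_2<\cdots<\Gamma_L$ and real $m>0$ satisfying - $\gcd(\Gamma_i,\Gamma_j)=1$ for all $i\neq j$, - $m\,\Gamma_L\le m_{\max}$, - $m\prod_{i=1}^L\Gamma_i\ge N_{\mathrm{th}}$. Then the following choices of $(\Gamma_1,\dots,\Gamma_L)$, with $m=m_{\max}/\Gamma_L$, satisfy these constraints and maximize $m$ (equivalently, minimize $\Gamma_L$ over all strictly increasing, pairwise coprime integers $2\le\Gamma_1<\cdots<\Gamma_L$ with $\prod_{i=1}^{L-1}\Gamma_i\ge\rho$). **Case $L=2$.** The optimal coprime pair is $\{\Gamma_1,\Gamma_2\}=\{\lceil\rho\rceil,\lceil\rho\rceil+1\}$. **Case $L=3$.** When $1<\rho\le 6$, the unique optimal triple is $(\Gamma_1,\Gamma_2,\Gamma_3)=(2,3,5)$. When $\rho>6$, let $b=\min\{n\in\mathbb Z,\ n\ge 3:\ n(n-1)\ge\rho\}$. Then the optimal triple is - $\{b-1,b,b+1\}$ if $b$ is even; - $\{b-2,b,b+1\}$ if $b$ is odd, $b\ge5$, $(b-2)b\ge\rho$ and $(b+1)\bmod 3\neq0$; - $\{b,b+1,b+2\}$ otherwise. **Case $L=4$.** When $1<\rho\le 30$, the unique optimal (sorted, pairwise coprime) quadruple is $(\Gamma_1,\Gamma_2,\Gamma_3,\Gamma_4)=(2,3,5,7)$.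 When $\rho>30$, let $b=\min\{n\in\mathbb Z,\ n\ge5:\ n(n-1)(n-2)\ge\rho\}$. Then the optimal quartet $\{\Gamma_1,\Gamma_2,\Gamma_3,\Gamma_4\}$ is as follows. (A) $b$ odd: - A1: if $b\bmod3\neq1$: $\{b-2,b-1,b,b+2\}$; - A2: if $b\bmod3=1$: $\{b-2,b,b+1,b+2\}$. (B) $b$ even with $(b-3)(b-1)b\ge\rho$: - B1: if $b\bmod6\in\{2,4\}$: $\{b-3,b-1,b,b+1\}$; - B2: if $b\bmod6=0$ and $b\bmod5\neq3$: $\{b-3,b-1,b+1,b+2\}$; - B3: if $b\bmod6=0$ and $b\bmod5=3$: (B3.1) $\{b-5,b-1,b+1,b+2\}$ if $(b-5)(b-1)(b+1)\ge\rho$ and $b\bmod7\neq5$; (B3.2) $\{b-1,b+1,b+2,b+3\}$ otherwise. (C) $b$ even with $(b-3)(b-1)b<\rho\le(b-3)(b-1)(b+1)$: - C1: if $b\bmod3\neq1$ and $b\bmod5\neq3$: $\{b-3,b-1,b+1,b+2\}$; - C2: if $b\bmod3=1$ and $b\bmod5\neq3$: $\{b-1,b,b+1,b+3\}$; - C3: if $b\bmod5=3$: (C3.1) $\{b-1,b+1,b+2,b+3\}$ if $b\bmod3\neq1$; (C3.2) $\{b-1,b,b+1,b+3\}$ if $b\bmod3=1$. (D) $b$ even with $(b-3)(b-1)(b+1)<\rho$: - D1: if $b\bmod3\neq0$ and $b\bmod5\neq3$: $\{b-1,b,b+1,b+3\}$; - D2: if $b\bmod3=0$ or $b\bmod5=3$: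 $\{b-1,b+1,b+2,b+3\}$.
   Context: The moduli of the system are $m_i=m\Gamma_i$, $1\le i\le L$, where $m>0$ is a real scaling factor. $m_{\max}$ is the maximum allowed modulus and $N_{\mathrm{th}}$ is the required dynamic range. For given $\Gamma_1<\dots<\Gamma_L$ the largest $m$ allowed by the modulus bound is $m=m_{\max}/\Gamma_L$; for this $m$ the dynamic range constraint reads $\prod_{i=1}^{L-1}\Gamma_i\ge\rho$. "Optimal" means that $m=m_{\max}/\Gamma_L$ is maximal, i.e. $\Gamma_L$ is minimal. $a\bmod n$ denotes the remainder in $\{0,\dots,n-1\}$ of $a$ upon division by $n$.
   Formalization: "Unique optimal" for (2,3,5) and (2,3,5,7) is false ((3,4,5), (3,4,5,7) tie); proved: optimal, with strictly smallest product among optimal ones. In D2 with b mod 3=1 and b mod 5=3 the printed set is not coprime (3 | b-1, b+2); {b-1,b,b+1,b+3} is used. *)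

theory Defs
  imports Complex_Main
begin

text \<open>The tuple \<open>\<Gamma>\<^sub>1 < \<dots> < \<Gamma>\<^sub>L\<close> is the integer list \<open>G\<close>, so \<open>\<Gamma>\<^sub>L\<close> is \<^term>\<open>last G\<close>. Its entries are
  distinct, hence \<^term>\<open>pairwise coprime (set G)\<close> is coprimality at all pairs of different positions.\<close>

definition coprime_tuple :: "nat \<Rightarrow> int list \<Rightarrow> bool" where
  "coprime_tuple L G \<longleftrightarrow>
     length G = L \<and> sorted_wrt (<) G \<and> (\<forall>g\<in>set G. 2 \<le> g) \<and> pairwise coprime (set G)"

definition feasible :: "nat \<Rightarrow> real \<Rightarrow> real \<Rightarrow> int list \<times> real \<Rightarrow> bool" where
  "feasible L m_max N_th = (\<lambda>(G, m).
     coprime_tuple L G \<and> 0 < m \<and> m * of_int (last G) \<le> m_max \<and> N_th \<le> m * of_int (prod_list G))"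

definition optimal :: "nat \<Rightarrow> real \<Rightarrow> real \<Rightarrow> int list \<Rightarrow> bool" where
  "optimal L m_max N_th G \<longleftrightarrow>
     is_arg_max snd (feasible L m_max N_th) (G, m_max / of_int (last G))"

definition minimizes_last :: "nat \<Rightarrow> real \<Rightarrow> int list \<Rightarrow> bool" where
  "minimizes_last L \<rho> G \<longleftrightarrow>
     is_arg_min last (\<lambda>H. coprime_tuple L H \<and> \<rho> \<le> of_int (prod_list (butlast H))) G"

end

theory Submission
  imports Defs "HOL-Computational_Algebra.Primes"
begin

text \<open>With \<open>N = \<lceil>\<rho>\<rceil>\<close> everything is a question about integers. By minimality of \<open>b\<close>, a
  tuple of width \<open>L\<close> whose largest entry is at most \<open>b\<close> has too small a product. For the largest
  entries \<open>b + 1\<close> and \<open>b + 2\<close> that remain, an even largest entry forces all others to be odd, an odd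
  one leaves room for a single even entry, and a prime \<open>p \<in> {3, 5, 7}\<close> dividing the largest entry
  excludes the numbers \<open>p\<close> below it; this bounds the product below \<open>N\<close> exactly in the cases in
  which a larger last entry is claimed.\<close>

section \<open>Reduction of the optimization to integer tuples\<close>

text \<open>At the scale \<open>m_max / last H\<close> the dynamic range is
  \<open>m_max * prod_list (butlast H)\<close>, so that constraint reads
  \<open>\<rho> \<le> prod_list (butlast H)\<close>. Any smaller admissible scale demands more of
  the product, hence nothing is lost by taking this one, and it is largest when
  \<open>last H\<close> is smallest.\<close>

lemma optimal_iff_minimizes_last:
  fixes m_max N_th \<rho> :: real
  assumes "0 < m_max" and \<rho>: "\<rho> = N_th / m_max" and "0 < L"
  shows "optimal L m_max N_th G \<longleftrightarrow> minimizes_last L \<rho> G"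
proof -
  have last_pos: "0 < last H" and prod_pos: "0 < prod_list (butlast H)"
    and prod_eq: "prod_list H = prod_list (butlast H) * last H" if "coprime_tuple L H" for H
  proof -
    have "H \<noteq> []" and ge: "\<forall>g\<in>set H. 2 \<le> g"
      using that \<open>0 < L\<close> by (auto simp: coprime_tuple_def)
    then show "0 < last H"
      using last_in_set by fastforce
    have "\<forall>g\<in>set xs. 2 \<le> g \<Longrightarrow> 0 < prod_list xs" for xs :: "int list"
      by (induction xs) auto
    then show "0 < prod_list (butlast H)"
      using ge in_set_butlastD by metis
    show "prod_list H = prod_list (butlast H) * last H"
      using \<open>H \<noteq> []\<close> by (metis append_butlast_last_id prod_list.Nil prod_list.Cons prod_list.append mult.right_neutral)
  qed
  have feasible_max: "feasible L m_max N_th (H, m_max / of_int (last H)) \<longleftrightarrow>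
      coprime_tuple L H \<and> \<rho> \<le> of_int (prod_list (butlast H))" for H
    using last_pos[of H] prod_eq[of H] assms
    by (auto simp: feasible_def divide_simps mult.commute)
  have le_max: "m \<le> m_max / of_int (last H)" and
    reaches: "\<rho> \<le> of_int (prod_list (butlast H))" if "feasible L m_max N_th (H, m)" for H m
  proof -
    have H: "coprime_tuple L H" and m: "0 < m" "m * of_int (last H) \<le> m_max"
      and N: "N_th \<le> m * of_int (prod_list H)"
      using that by (auto simp: feasible_def)
    show "m \<le> m_max / of_int (last H)"
      using m last_pos[OF H] by (simp add: field_simps)
    have "N_th \<le> (m * of_int (last H)) * of_int (prod_list (butlast H))"
      using N prod_eq[OF H] by (simp add: mult_ac)
    also have "\<dots> \<le> m_max * of_int (prod_list (butlast H))"
      using m prod_pos[OF H] by (intro mult_right_mono) auto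
    finally show "\<rho> \<le> of_int (prod_list (butlast H))"
      unfolding \<rho> using \<open>0 < m_max\<close> by (simp add: pos_divide_le_eq mult.commute)
  qed
  show ?thesis
  proof
    assume opt: "optimal L m_max N_th G"
    then have G: "coprime_tuple L G" "\<rho> \<le> of_int (prod_list (butlast G))"
      using feasible_max by (auto simp: optimal_def is_arg_max_def)
    have "\<not> last H < last G" if H: "coprime_tuple L H" "\<rho> \<le> of_int (prod_list (butlast H))" for H
    proof
      assume "last H < last G"
      then have "m_max / of_int (last G) < m_max / of_int (last H)"
        using last_pos[OF H(1)] \<open>0 < m_max\<close> by (intro divide_strict_left_mono) auto
      then show False
        using opt H feasible_max[of H] unfolding optimal_def is_arg_max_def
        by (metis snd_conv)
    qed
    then show "minimizes_last L \<rho> G"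
      using G by (auto simp: minimizes_last_def is_arg_min_def)
  next
    assume "minimizes_last L \<rho> G"
    then have G: "coprime_tuple L G" "\<rho> \<le> of_int (prod_list (butlast G))"
      and min: "\<And>H. coprime_tuple L H \<Longrightarrow> \<rho> \<le> of_int (prod_list (butlast H)) \<Longrightarrow> last G \<le> last H"
      by (auto simp: minimizes_last_def is_arg_min_def not_less)
    have "m \<le> m_max / of_int (last G)" if f: "feasible L m_max N_th (H, m)" for H m
    proof -
      have "coprime_tuple L H"
        using f by (simp add: feasible_def)
      then have "m_max / of_int (last H) \<le> m_max / of_int (last G)"
        using min reaches[OF f] last_pos G(1) \<open>0 < m_max\<close> by (intro divide_left_mono) auto
      then show ?thesis
        using le_max[OF f] by linarith
    qed
    then show "optimal L m_max N_th G"
      using G feasible_max[of G] by (force simp: optimal_def is_arg_max_def not_less)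
  qed
qed

section \<open>Coprime tuples of length two, three and four as explicit lists\<close>

text \<open>Symmetry of \<open>coprime\<close> merges the two directions in
  \<open>pairwise_insert\<close>, so an explicit list unfolds to one condition per pair.\<close>

lemma pairwise_coprime_insert:
  fixes x :: int
  shows "pairwise coprime (insert x S) \<longleftrightarrow>
    (\<forall>y\<in>S. x \<noteq> y \<longrightarrow> coprime x y) \<and> pairwise coprime S"
proof -
  have "coprime y x \<longleftrightarrow> coprime x y" for y
    by (rule coprime_commute)
  then show ?thesis
    unfolding pairwise_insert by metis
qed

lemma coprime_tuple_2:
  "coprime_tuple 2 [x, y] \<longleftrightarrow> 2 \<le> x \<and> x < y \<and> coprime x y"
  by (auto simp: coprime_tuple_def pairwise_coprime_insert)

lemma coprime_tuple_3:
  "coprime_tuple 3 [x, y, z] \<longleftrightarrow>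
     2 \<le> x \<and> x < y \<and> y < z \<and> coprime x y \<and> coprime x z \<and> coprime y z"
  by (auto simp: coprime_tuple_def pairwise_coprime_insert)

lemma coprime_tuple_4:
  "coprime_tuple 4 [x, y, z, w] \<longleftrightarrow>
     2 \<le> x \<and> x < y \<and> y < z \<and> z < w \<and>
     coprime x y \<and> coprime x z \<and> coprime x w \<and> coprime y z \<and> coprime y w \<and> coprime z w"
  by (auto simp: coprime_tuple_def pairwise_coprime_insert)

lemma coprime_tuple_2E:
  assumes "coprime_tuple 2 H"
  obtains x y where "H = [x, y]"
  using assms by (auto simp: coprime_tuple_def numeral_eq_Suc length_Suc_conv)

lemma coprime_tuple_3E:
  assumes "coprime_tuple 3 H"
  obtains x y z where "H = [x, y, z]"
  using assms by (auto simp: coprime_tuple_def numeral_eq_Suc length_Suc_conv)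

lemma coprime_tuple_4E:
  assumes "coprime_tuple 4 H"
  obtains x y z w where "H = [x, y, z, w]"
  using assms by (auto simp: coprime_tuple_def numeral_eq_Suc length_Suc_conv)

text \<open>Products of entries are integers, so \<open>\<rho>\<close> may be replaced by its
  ceiling. What remains is to exhibit one admissible tuple and to bound the last entry of all others
  from below; the versions for three and four entries work the same way.\<close>

lemma minimizes_last_2I:
  assumes "coprime_tuple 2 [p, q]" and "\<lceil>\<rho>\<rceil> \<le> p"
    and "\<And>x y. coprime_tuple 2 [x, y] \<Longrightarrow> \<lceil>\<rho>\<rceil> \<le> x \<Longrightarrow> q \<le> y"
  shows "minimizes_last 2 \<rho> [p, q]"
proof -
  have "q \<le> last H" if H: "coprime_tuple 2 H" "\<lceil>\<rho>\<rceil> \<le> prod_list (butlast H)" for H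
    using H(1) by (rule coprime_tuple_2E) (use H assms(3) in \<open>simp add: mult.assoc\<close>)
  then show ?thesis
    unfolding minimizes_last_def is_arg_min_def ceiling_le_iff[symmetric] not_ex
    using assms(1,2) by (force simp: mult.assoc not_less)
qed

lemma minimizes_last_3I:
  assumes "coprime_tuple 3 [p, q, r]" and "\<lceil>\<rho>\<rceil> \<le> p * q"
    and "\<And>x y z. coprime_tuple 3 [x, y, z] \<Longrightarrow> \<lceil>\<rho>\<rceil> \<le> x * y \<Longrightarrow> r \<le> z"
  shows "minimizes_last 3 \<rho> [p, q, r]"
proof -
  have "r \<le> last H" if H: "coprime_tuple 3 H" "\<lceil>\<rho>\<rceil> \<le> prod_list (butlast H)" for H
    using H(1) by (rule coprime_tuple_3E) (use H assms(3) in \<open>simp add: mult.assoc\<close>)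
  then show ?thesis
    unfolding minimizes_last_def is_arg_min_def ceiling_le_iff[symmetric] not_ex
    using assms(1,2) by (force simp: mult.assoc not_less)
qed

lemma minimizes_last_4I:
  assumes "coprime_tuple 4 [p, q, r, s]" and "\<lceil>\<rho>\<rceil> \<le> p * q * r"
    and "\<And>x y z w. coprime_tuple 4 [x, y, z, w] \<Longrightarrow> \<lceil>\<rho>\<rceil> \<le> x * y * z \<Longrightarrow> s \<le> w"
  shows "minimizes_last 4 \<rho> [p, q, r, s]"
proof -
  have "s \<le> last H" if H: "coprime_tuple 4 H" "\<lceil>\<rho>\<rceil> \<le> prod_list (butlast H)" for H
    using H(1) by (rule coprime_tuple_4E) (use H assms(3) in \<open>simp add: mult.assoc\<close>)
  then show ?thesis
    unfolding minimizes_last_def is_arg_min_def ceiling_le_iff[symmetric] not_ex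
    using assms(1,2) by (force simp: mult.assoc not_less)
qed

section \<open>Coprimality of integers at small distance\<close>

lemma coprime_from_diff:
  fixes x y :: int
  shows "coprime x (y - x) \<Longrightarrow> coprime x y"
  by (rule coprimeI) (blast intro: coprime_common_divisor dvd_diff)

lemma coprime_prime_numeral:
  fixes x p :: int
  assumes "prime p" and "x mod p \<noteq> 0"
  shows "coprime x p"
proof -
  have "\<not> p dvd x"
    using assms(2) by (metis dvd_imp_mod_0)
  then show ?thesis
    using prime_imp_coprime[OF assms(1)] coprime_commute by blast
qed

lemma coprime_small:
  fixes x :: int
  shows "odd x \<Longrightarrow> coprime x 2"
    and "x mod 3 \<noteq> 0 \<Longrightarrow> coprime x 3"
    and "odd x \<Longrightarrow> coprime x 4"
    and "x mod 5 \<noteq> 0 \<Longrightarrow> coprime x 5"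
    and "odd x \<Longrightarrow> x mod 3 \<noteq> 0 \<Longrightarrow> coprime x 6"
    and "x mod 7 \<noteq> 0 \<Longrightarrow> coprime x 7"
proof -
  show 2: "odd x \<Longrightarrow> coprime x 2"
    by simp
  show 3: "x mod 3 \<noteq> 0 \<Longrightarrow> coprime x 3" and "x mod 5 \<noteq> 0 \<Longrightarrow> coprime x 5"
    and "x mod 7 \<noteq> 0 \<Longrightarrow> coprime x 7"
    by (simp_all add: coprime_prime_numeral)
  show "odd x \<Longrightarrow> coprime x 4"
    using coprime_mult_right_iff[of x 2 2] by simp
  show "odd x \<Longrightarrow> x mod 3 \<noteq> 0 \<Longrightarrow> coprime x 6"
    using coprime_mult_right_iff[of x 2 3] 3 by simp
qed

text \<open>A common divisor of \<open>x\<close> and \<open>y\<close> divides \<open>y - x\<close>,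
  so only the primes 2, 3, 5 and 7 matter. The distance 7 is the largest inside the claimed tuples,
  namely from \<open>b - 5\<close> to \<open>b + 2\<close>.\<close>

lemma coprime_near:
  fixes x y :: int
  assumes "1 \<le> y - x" and "y - x \<le> 7"
    and "even (y - x) \<Longrightarrow> odd x" and "3 dvd y - x \<Longrightarrow> x mod 3 \<noteq> 0"
    and "y - x = 5 \<Longrightarrow> x mod 5 \<noteq> 0" and "y - x = 7 \<Longrightarrow> x mod 7 \<noteq> 0"
  shows "coprime x y"
proof (rule coprime_from_diff)
  have "y - x = 1 \<or> y - x = 2 \<or> y - x = 3 \<or> y - x = 4 \<or> y - x = 5 \<or> y - x = 6 \<or> y - x = 7"
    using assms(1,2) by presburger
  then show "coprime x (y - x)"
    using assms(3-6) coprime_small[of x] by (elim disjE) auto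
qed

text \<open>The source of all upper bounds on products: once \<open>p\<close> divides one entry, the
  multiples of \<open>p\<close> are barred from the other positions.\<close>

lemma not_both_dvd:
  fixes x y p :: int
  assumes "coprime x y" and "1 < p"
  shows "\<not> (p dvd x \<and> p dvd y)"
proof
  assume "p dvd x \<and> p dvd y"
  then have "is_unit p"
    using assms(1) coprime_common_divisor by blast
  then show False
    using assms(2) by simp
qed

lemma mult3_mono:
  fixes x y z :: int
  assumes "x \<le> A" "y \<le> B" "z \<le> C" "0 \<le> x" "0 \<le> y" "0 \<le> z"
  shows "x * y * z \<le> A * B * C"
  using assms by (intro mult_mono mult_nonneg_nonneg) linarith+

lemma coprime_tuple_4_order:
  assumes "coprime_tuple 4 [x, y, z, w]"
  shows "2 \<le> x" "x < y" "y < z" "z < w"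
  using assms by (simp_all add: coprime_tuple_4)

section \<open>Products of pairwise coprime quadruples\<close>

lemma prod_le_of_last:
  assumes "coprime_tuple 4 [x, y, z, w]" and "w \<le> c"
  shows "x * y * z \<le> (c - 3) * (c - 2) * (c - 1)"
  using assms by (intro mult3_mono) (auto simp: coprime_tuple_4)

lemma even_last_odd:
  assumes "coprime_tuple 4 [x, y, z, w]" and "even w"
  shows "odd x" "odd y" "odd z" and "x \<le> w - 5" "y \<le> w - 3" "z \<le> w - 1"
proof -
  show o: "odd x" "odd y" "odd z"
    using assms not_both_dvd[of x w 2] not_both_dvd[of y w 2] not_both_dvd[of z w 2]
    by (auto simp: coprime_tuple_4)
  show "x \<le> w - 5" "y \<le> w - 3" "z \<le> w - 1"
    using coprime_tuple_4_order[OF assms(1)] o \<open>even w\<close> by presburger+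
qed

lemma prod_le_even_last:
  assumes "coprime_tuple 4 [x, y, z, w]" and "even w"
  shows "x * y * z \<le> (w - 5) * (w - 3) * (w - 1)"
  using assms even_last_odd[OF assms] by (intro mult3_mono) (auto simp: coprime_tuple_4)

text \<open>The value \<open>w - 3\<close> is a multiple of 3 and thus barred for \<open>y\<close>,
  so the odd number \<open>y\<close> drops to \<open>w - 5\<close> and pushes the odd number
  \<open>x\<close> down to \<open>w - 7\<close>.\<close>

lemma prod_le_even_last_3:
  assumes "coprime_tuple 4 [x, y, z, w]" and "even w" and "3 dvd w"
  shows "x * y * z \<le> (w - 7) * (w - 5) * (w - 1)"
proof -
  note o = even_last_odd[OF assms(1,2)]
  have "\<not> 3 dvd y"
    using assms not_both_dvd[of y w 3] by (auto simp: coprime_tuple_4)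
  then have "y \<noteq> w - 3"
    using \<open>3 dvd w\<close> by presburger
  then have "y \<le> w - 5"
    using o(2,5) \<open>y \<noteq> w - 3\<close> \<open>even w\<close> by presburger
  moreover have "x \<le> w - 7"
    using calculation o(1,2) coprime_tuple_4_order(2)[OF assms(1)] \<open>even w\<close> by presburger
  ultimately show ?thesis
    using assms o by (intro mult3_mono) (auto simp: coprime_tuple_4)
qed

text \<open>The top odd choice \<open>w - 5\<close> for \<open>x\<close> is now a multiple of 5, so
  \<open>x\<close> drops to \<open>w - 7\<close>; if 7 divides \<open>w\<close> too, that value is
  barred as well and \<open>w - 9\<close> is next.\<close>

lemma prod_le_even_last_5:
  assumes "coprime_tuple 4 [x, y, z, w]" and "even w" and "5 dvd w"
  shows "x * y * z \<le> (w - 7) * (w - 3) * (w - 1)"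
    and "7 dvd w \<Longrightarrow> x * y * z \<le> (w - 9) * (w - 3) * (w - 1)"
proof -
  note o = even_last_odd[OF assms(1,2)]
  have "\<not> 5 dvd x"
    using assms not_both_dvd[of x w 5] by (auto simp: coprime_tuple_4)
  then have "x \<noteq> w - 5"
    using \<open>5 dvd w\<close> by presburger
  then have x: "x \<le> w - 7"
    using o(1,4) \<open>even w\<close> by presburger
  then show "x * y * z \<le> (w - 7) * (w - 3) * (w - 1)"
    using assms o by (intro mult3_mono) (auto simp: coprime_tuple_4)
  assume "7 dvd w"
  have "\<not> 7 dvd x"
    using assms \<open>7 dvd w\<close> not_both_dvd[of x w 7] by (auto simp: coprime_tuple_4)
  then have "x \<noteq> w - 7"
    using \<open>7 dvd w\<close> by presburger
  then have "x \<le> w - 9"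
    using x o(1) \<open>even w\<close> by presburger
  then show "x * y * z \<le> (w - 9) * (w - 3) * (w - 1)"
    using assms o by (intro mult3_mono) (auto simp: coprime_tuple_4)
qed

lemma coprime_tuple_4_parity:
  assumes "coprime_tuple 4 [x, y, z, w]"
  shows "odd x \<or> odd y" "odd x \<or> odd z" "odd y \<or> odd z"
  using assms not_both_dvd[of x y 2] not_both_dvd[of x z 2] not_both_dvd[of y z 2]
  by (auto simp: coprime_tuple_4)

text \<open>The three numbers just below \<open>w\<close> contain the two even numbers
  \<open>w - 3\<close> and \<open>w - 1\<close>, so \<open>x\<close> cannot be as large as
  \<open>w - 3\<close>.\<close>

lemma prod_le_odd_last:
  assumes "coprime_tuple 4 [x, y, z, w]" and "odd w"
  shows "x * y * z \<le> (w - 4) * (w - 2) * (w - 1)"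
proof -
  note ord = coprime_tuple_4_order[OF assms(1)]
  have "\<not> (x = w - 3 \<and> z = w - 1)"
    using coprime_tuple_4_parity(2)[OF assms(1)] \<open>odd w\<close> by auto
  then have "x \<le> w - 4" "y \<le> w - 2" "z \<le> w - 1"
    using ord by linarith+
  then show ?thesis
    using assms by (intro mult3_mono) (auto simp: coprime_tuple_4)
qed

text \<open>Either \<open>w - 1\<close> is left out and every entry moves down, or
  \<open>z = w - 1\<close> is a multiple of 6 and bars even numbers and multiples of 3 from
  \<open>x\<close> and \<open>y\<close>. For \<open>w = b + 1\<close> the bound is the product that
  the minimality of \<open>b\<close> keeps below \<open>N\<close>.\<close>

lemma prod_le_odd_last_3:
  assumes t: "coprime_tuple 4 [x, y, z, w]" and "odd w" and "3 dvd w - 1" and "7 \<le> w"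
  shows "x * y * z \<le> (w - 4) * (w - 3) * (w - 2)"
proof (cases "z = w - 1")
  case False
  have "x \<le> w - 4" "y \<le> w - 3" "z \<le> w - 2"
    using coprime_tuple_4_order[OF t] False by linarith+
  then show ?thesis
    using t by (intro mult3_mono) (auto simp: coprime_tuple_4)
next
  case True
  note par = coprime_tuple_4_parity[OF t]
  have "odd x" "odd y"
    using True par \<open>odd w\<close> by auto
  have "\<not> 3 dvd x" "\<not> 3 dvd y"
    using t \<open>3 dvd w - 1\<close> True not_both_dvd[of x z 3] not_both_dvd[of y z 3]
    by (auto simp: coprime_tuple_4)
  have y: "y \<le> w - 2"
    using coprime_tuple_4_order[OF t] True by linarith
  \<comment> \<open>The odd candidate \<open>w - 4\<close> is a multiple of 3, because
    \<open>w - 1\<close> is.\<close>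
  have x: "x \<le> w - 6"
    using coprime_tuple_4_order(2)[OF t] \<open>odd x\<close> \<open>odd y\<close> \<open>\<not> 3 dvd x\<close> \<open>\<not> 3 dvd y\<close> \<open>odd w\<close>
      \<open>3 dvd w - 1\<close> y by presburger
  have "x * y * z \<le> (w - 6) * (w - 2) * (w - 1)"
    using t x y by (intro mult3_mono) (auto simp: coprime_tuple_4)
  \<comment> \<open>The two sides differ by \<open>6 * (w - 2)\<close>.\<close>
  also have "\<dots> \<le> (w - 4) * (w - 3) * (w - 2)"
    using \<open>7 \<le> w\<close> by (simp add: algebra_simps)
  finally show ?thesis .
qed

section \<open>Lower bounds for the last entry of a quadruple\<close>

text \<open>These facts express that \<open>b\<close> is the least integer from 5 on with
  \<open>N \<le> b * (b - 1) * (b - 2)\<close>; \<open>below\<close> is the failure of this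
  inequality at \<open>b - 1\<close>. For \<open>b = 5\<close> it reads \<open>24 < N\<close>, which
  the range \<open>30 < N\<close> supplies.\<close>

locale quartet_width =
  fixes N b :: int
  assumes ge_5: "5 \<le> b"
    and below: "(b - 3) * (b - 2) * (b - 1) < N"
    and within: "N \<le> b * (b - 1) * (b - 2)"
begin

text \<open>In the comparisons of products below the cubic terms cancel after expansion; this fact
  then settles the quadratic remainder by linear arithmetic with \<open>b * b\<close> as an
  atom.\<close>

lemma five_times_le_square: "5 * b \<le> b * b"
  using ge_5 by (intro mult_right_mono) auto

lemma last_ge_1:
  assumes "coprime_tuple 4 [x, y, z, w]" and "N \<le> x * y * z"
  shows "b + 1 \<le> w"
proof (rule ccontr)
  assume "\<not> b + 1 \<le> w"
  then show False
    using prod_le_of_last[OF assms(1), of b] assms(2) below by linarith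
qed

text \<open>A last entry \<open>b + 1\<close> would be even, and three odd numbers below it have
  product at most \<open>(b - 4) * (b - 2) * b\<close>, which is \<open>3 * (b - 2)\<close> less
  than the left side of \<open>below\<close>.\<close>

lemma last_ge_2_odd:
  assumes t: "coprime_tuple 4 [x, y, z, w]" and N: "N \<le> x * y * z" and "odd b"
  shows "b + 2 \<le> w"
proof -
  have "w \<noteq> b + 1"
  proof
    assume w: "w = b + 1"
    then have "x * y * z \<le> (w - 5) * (w - 3) * (w - 1)"
      using prod_le_even_last[OF t] \<open>odd b\<close> by simp
    then have "N \<le> (b + 1 - 5) * (b + 1 - 3) * (b + 1 - 1)"
      using N w by simp
    then show False
      using below ge_5 by (simp only: algebra_simps)
  qed
  then show ?thesis
    using last_ge_1[OF t N] by linarith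
qed

text \<open>A last entry \<open>b + 1\<close> is odd and allows products up to
  \<open>(b - 3) * (b - 1) * b\<close>, the threshold between cases B and C. If 3 divides
  \<open>b\<close>, the sharper bound for odd last entries contradicts \<open>below\<close>.\<close>

lemma last_ge_2_even:
  assumes t: "coprime_tuple 4 [x, y, z, w]" and N: "N \<le> x * y * z" and "even b"
    and "3 dvd b \<or> (b - 3) * (b - 1) * b < N"
  shows "b + 2 \<le> w"
proof -
  have "w \<noteq> b + 1"
  proof
    assume w: "w = b + 1"
    have "6 \<le> b"
      using ge_5 \<open>even b\<close> by presburger
    have "x * y * z \<le> (w - 4) * (w - 2) * (w - 1)"
      and "3 dvd b \<Longrightarrow> x * y * z \<le> (w - 4) * (w - 3) * (w - 2)"
      using prod_le_odd_last[OF t] prod_le_odd_last_3[OF t] \<open>even b\<close> \<open>6 \<le> b\<close> w by auto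
    then show False
      using N below assms(4) w by (auto simp: algebra_simps)
  qed
  then show ?thesis
    using last_ge_1[OF t N] by linarith
qed

text \<open>The threshold between cases C and D is the product of the three largest admissible odd
  numbers below the even entry \<open>b + 2\<close>.\<close>

lemma last_ge_3_large:
  assumes t: "coprime_tuple 4 [x, y, z, w]" and N: "N \<le> x * y * z" and "even b"
    and large: "(b - 3) * (b - 1) * (b + 1) < N"
  shows "b + 3 \<le> w"
proof -
  have "0 \<le> (b - 3) * (b - 1)"
    using ge_5 by simp
  then have "(b - 3) * (b - 1) * b \<le> (b - 3) * (b - 1) * (b + 1)"
    by (intro mult_left_mono) auto
  then have "b + 2 \<le> w"
    using large last_ge_2_even[OF t N \<open>even b\<close>] by linarith
  moreover have "w \<noteq> b + 2"
  proof
    assume w: "w = b + 2"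
    then have "x * y * z \<le> (w - 5) * (w - 3) * (w - 1)"
      using prod_le_even_last[OF t] \<open>even b\<close> by simp
    then show False
      using N w large by (simp add: add.commute)
  qed
  ultimately show ?thesis
    by linarith
qed

lemma last_ge_3_mod3:
  assumes t: "coprime_tuple 4 [x, y, z, w]" and N: "N \<le> x * y * z" and "even b"
    and medium: "(b - 3) * (b - 1) * b < N" and "3 dvd b + 2"
  shows "b + 3 \<le> w"
proof -
  have "w \<noteq> b + 2"
  proof
    assume w: "w = b + 2"
    then have "x * y * z \<le> (w - 7) * (w - 5) * (w - 1)"
      using prod_le_even_last_3[OF t] \<open>even b\<close> \<open>3 dvd b + 2\<close> by simp
    then have "N \<le> (b + 2 - 7) * (b + 2 - 5) * (b + 2 - 1)"
      using N w by simp
    then show False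
      using medium five_times_le_square ge_5 by (simp only: algebra_simps)
  qed
  then show ?thesis
    using last_ge_2_even[OF t N \<open>even b\<close>] medium by linarith
qed

text \<open>The disjunction \<open>disj\<close> is the failure of the condition for B3.1: when 5
  divides \<open>b + 2\<close>, the best remaining product is
  \<open>(b - 5) * (b - 1) * (b + 1)\<close>, and a further factor 7 of \<open>b + 2\<close> removes
  that one too.\<close>

lemma last_ge_3_mod5:
  assumes t: "coprime_tuple 4 [x, y, z, w]" and N: "N \<le> x * y * z" and "even b"
    and ge_2: "3 dvd b \<or> (b - 3) * (b - 1) * b < N" and "5 dvd b + 2"
    and disj: "(b - 5) * (b - 1) * (b + 1) < N \<or> 7 dvd b + 2"
  shows "b + 3 \<le> w"
proof -
  have "w \<noteq> b + 2"
  proof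
    assume w: "w = b + 2"
    have "x * y * z \<le> (w - 7) * (w - 3) * (w - 1)"
      and 7: "7 dvd b + 2 \<Longrightarrow> x * y * z \<le> (w - 9) * (w - 3) * (w - 1)"
      using prod_le_even_last_5[OF t] \<open>even b\<close> \<open>5 dvd b + 2\<close> w by auto
    then have "7 dvd b + 2"
      using disj N w by (auto simp: add.commute)
    \<comment> \<open>This product lies below \<open>(b - 3) * (b - 2) * (b - 1)\<close>, against
      the minimality of \<open>b\<close>.\<close>
    then have "N \<le> (b + 2 - 9) * (b + 2 - 3) * (b + 2 - 1)"
      using 7 N w by simp
    then show False
      using below five_times_le_square ge_5 by (simp only: algebra_simps)
  qed
  moreover have "b + 2 \<le> w"
    using last_ge_2_even[OF t N \<open>even b\<close> ge_2] .
  ultimately show ?thesis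
    by linarith
qed

text \<open>Beyond the threshold of case B the tuple starting with \<open>b - 5\<close> falls short,
  which is why C3 has no analogue of B3.1.\<close>

lemma medium_imp:
  assumes "(b - 3) * (b - 1) * b < N"
  shows "(b - 5) * (b - 1) * (b + 1) < N"
  using assms five_times_le_square ge_5 by (simp only: algebra_simps)

text \<open>These are the products without the last entry for A1, A2,
  \<open>[b - 1, b, b + 1, b + 3]\<close> and \<open>[b - 1, b + 1, b + 2, b + 3]\<close>, in this
  order; none is smaller than \<open>b * (b - 1) * (b - 2)\<close>.\<close>

lemma within_products:
  shows "N \<le> (b - 2) * (b - 1) * b" and "N \<le> (b - 2) * b * (b + 1)"
    and "N \<le> (b - 1) * b * (b + 1)" and "N \<le> (b - 1) * (b + 1) * (b + 2)"
  using within five_times_le_square ge_5 by (simp_all only: algebra_simps)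

lemma small_imp:
  assumes "N \<le> (b - 3) * (b - 1) * b"
  shows "N \<le> (b - 3) * (b - 1) * (b + 1)"
  using assms five_times_le_square ge_5 by (simp only: algebra_simps)

section \<open>Optimal quadruples\<close>

text \<open>The only distance divisible by 3 is from \<open>b - 1\<close> to \<open>b + 2\<close>.
  When it spoils coprimality, that is for \<open>b mod 3 = 1\<close>, A2 trades \<open>b - 1\<close>
  for \<open>b + 1\<close>.\<close>

lemma minimal_A1:
  assumes "\<lceil>\<rho>\<rceil> = N" "odd b" "b mod 3 \<noteq> 1"
  shows "minimizes_last 4 \<rho> [b - 2, b - 1, b, b + 2]"
proof (rule minimizes_last_4I, unfold assms(1))
  show "coprime_tuple 4 [b - 2, b - 1, b, b + 2]"
    unfolding coprime_tuple_4 using assms(2,3) ge_5 by (intro conjI coprime_near) presburger+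
  show "b + 2 \<le> w" if "coprime_tuple 4 [x, y, z, w]" "N \<le> x * y * z" for x y z w
    using last_ge_2_odd[OF that assms(2)] .
qed (rule within_products)

lemma minimal_A2:
  assumes "\<lceil>\<rho>\<rceil> = N" "odd b" "b mod 3 = 1"
  shows "minimizes_last 4 \<rho> [b - 2, b, b + 1, b + 2]"
proof (rule minimizes_last_4I, unfold assms(1))
  show "coprime_tuple 4 [b - 2, b, b + 1, b + 2]"
    unfolding coprime_tuple_4 using assms(2,3) ge_5 by (intro conjI coprime_near) presburger+
  show "b + 2 \<le> w" if "coprime_tuple 4 [x, y, z, w]" "N \<le> x * y * z" for x y z w
    using last_ge_2_odd[OF that assms(2)] .
qed (rule within_products)

lemma minimal_B1:
  assumes "\<lceil>\<rho>\<rceil> = N" "even b" "N \<le> (b - 3) * (b - 1) * b" "b mod 6 \<in> {2, 4}"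
  shows "minimizes_last 4 \<rho> [b - 3, b - 1, b, b + 1]"
proof (rule minimizes_last_4I, unfold assms(1))
  have "b mod 3 \<noteq> 0"
    using assms(4) by (elim insertE emptyE) presburger+
  then show "coprime_tuple 4 [b - 3, b - 1, b, b + 1]"
    unfolding coprime_tuple_4 using assms(2) ge_5 by (intro conjI coprime_near) presburger+
  show "b + 1 \<le> w" if "coprime_tuple 4 [x, y, z, w]" "N \<le> x * y * z" for x y z w
    using last_ge_1[OF that] .
qed (rule assms(3))

text \<open>The residue conditions guard the distance 3 from \<open>b - 1\<close> to
  \<open>b + 2\<close> and the distance 5 from \<open>b - 3\<close> to \<open>b + 2\<close>.\<close>

lemma coprime_minus3:
  assumes "even b" "b mod 3 \<noteq> 1" "b mod 5 \<noteq> 3"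
  shows "coprime_tuple 4 [b - 3, b - 1, b + 1, b + 2]"
proof -
  have "(b - 1) mod 3 \<noteq> 0" "(b - 3) mod 5 \<noteq> 0"
    using assms(2,3) by presburger+
  then show ?thesis
    unfolding coprime_tuple_4 using assms(1) ge_5 by (intro conjI coprime_near) simp_all
qed

lemma coprime_plus3:
  assumes "even b" "b mod 3 \<noteq> 1"
  shows "coprime_tuple 4 [b - 1, b + 1, b + 2, b + 3]"
proof -
  have "(b - 1) mod 3 \<noteq> 0"
    using assms(2) by presburger+
  then show ?thesis
    unfolding coprime_tuple_4 using assms(1) ge_5 by (intro conjI coprime_near) simp_all
qed

lemma coprime_plus3':
  assumes "even b" "b mod 3 \<noteq> 0"
  shows "coprime_tuple 4 [b - 1, b, b + 1, b + 3]"
  unfolding coprime_tuple_4 using assms ge_5 by (intro conjI coprime_near) simp_all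

lemma minimal_minus3:
  assumes "\<lceil>\<rho>\<rceil> = N" "even b" "N \<le> (b - 3) * (b - 1) * (b + 1)"
    and "3 dvd b \<or> (b - 3) * (b - 1) * b < N" and "b mod 3 \<noteq> 1" "b mod 5 \<noteq> 3"
  shows "minimizes_last 4 \<rho> [b - 3, b - 1, b + 1, b + 2]"
proof (rule minimizes_last_4I, unfold assms(1))
  show "coprime_tuple 4 [b - 3, b - 1, b + 1, b + 2]"
    using assms by (intro coprime_minus3)
  show "b + 2 \<le> w" if "coprime_tuple 4 [x, y, z, w]" "N \<le> x * y * z" for x y z w
    using last_ge_2_even[OF that assms(2,4)] .
qed (rule assms(3))

text \<open>The lower bound on the last entry is left as a hypothesis because B3.2, C3.1 and D2
  obtain it from different obstructions.\<close>

lemma minimal_plus3: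
  assumes "\<lceil>\<rho>\<rceil> = N" "even b" "b mod 3 \<noteq> 1"
    and "\<And>x y z w. coprime_tuple 4 [x, y, z, w] \<Longrightarrow> N \<le> x * y * z \<Longrightarrow> b + 3 \<le> w"
  shows "minimizes_last 4 \<rho> [b - 1, b + 1, b + 2, b + 3]"
proof (rule minimizes_last_4I, unfold assms(1))
  show "coprime_tuple 4 [b - 1, b + 1, b + 2, b + 3]"
    using assms(2,3) by (rule coprime_plus3)
  show "b + 3 \<le> w" if "coprime_tuple 4 [x, y, z, w]" "N \<le> x * y * z" for x y z w
    using assms(4)[OF that] .
qed (rule within_products)

lemma minimal_plus3':
  assumes "\<lceil>\<rho>\<rceil> = N" "even b" "b mod 3 \<noteq> 0"
    and "\<And>x y z w. coprime_tuple 4 [x, y, z, w] \<Longrightarrow> N \<le> x * y * z \<Longrightarrow> b + 3 \<le> w"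
  shows "minimizes_last 4 \<rho> [b - 1, b, b + 1, b + 3]"
proof (rule minimizes_last_4I, unfold assms(1))
  show "coprime_tuple 4 [b - 1, b, b + 1, b + 3]"
    using assms(2,3) by (rule coprime_plus3')
  show "b + 3 \<le> w" if "coprime_tuple 4 [x, y, z, w]" "N \<le> x * y * z" for x y z w
    using assms(4)[OF that] .
qed (rule within_products)

lemma minimal_B3_1:
  assumes "\<lceil>\<rho>\<rceil> = N" "even b" "b mod 3 = 0" "b mod 5 = 3"
    and "N \<le> (b - 5) * (b - 1) * (b + 1)" "b mod 7 \<noteq> 5"
  shows "minimizes_last 4 \<rho> [b - 5, b - 1, b + 1, b + 2]"
proof (rule minimizes_last_4I, unfold assms(1))
  have "3 dvd b" "(b - 5) mod 3 \<noteq> 0" "(b - 1) mod 3 \<noteq> 0"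
    using assms(3) by presburger+
  moreover have "(b - 5) mod 7 \<noteq> 0"
    using assms(6) by presburger
  \<comment> \<open>With \<open>5 \<le> b\<close> this makes the first entry \<open>b - 5\<close> at
    least 2.\<close>
  moreover have "b \<noteq> 5" "b \<noteq> 6"
    using assms(2,4) by auto
  ultimately show "coprime_tuple 4 [b - 5, b - 1, b + 1, b + 2]"
    unfolding coprime_tuple_4 using assms(2) ge_5 by (intro conjI coprime_near) simp_all
  show "b + 2 \<le> w" if "coprime_tuple 4 [x, y, z, w]" "N \<le> x * y * z" for x y z w
    using last_ge_2_even[OF that assms(2) disjI1[OF \<open>3 dvd b\<close>]] .
qed (rule assms(5))

text \<open>If \<open>b mod 3 = 1\<close>, then 3 divides both \<open>b - 1\<close> and
  \<open>b + 2\<close>, so \<open>[b - 1, b + 1, b + 2, b + 3]\<close> is not pairwise coprime.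
  Hence in case D the residues \<open>b mod 5 = 3\<close>, \<open>b mod 3 = 1\<close> go with
  \<open>[b - 1, b, b + 1, b + 3]\<close>, which has the same last entry.\<close>

lemma minimal_quartet:
  assumes "\<lceil>\<rho>\<rceil> = N"
  shows "(odd b \<longrightarrow>
      (b mod 3 \<noteq> 1 \<longrightarrow> minimizes_last 4 \<rho> [b - 2, b - 1, b, b + 2]) \<and>
      (b mod 3 = 1 \<longrightarrow> minimizes_last 4 \<rho> [b - 2, b, b + 1, b + 2])) \<and>
    (even b \<and> N \<le> (b - 3) * (b - 1) * b \<longrightarrow>
      (b mod 6 \<in> {2, 4} \<longrightarrow> minimizes_last 4 \<rho> [b - 3, b - 1, b, b + 1]) \<and>
      (b mod 6 = 0 \<and> b mod 5 \<noteq> 3 \<longrightarrow>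
         minimizes_last 4 \<rho> [b - 3, b - 1, b + 1, b + 2]) \<and>
      (b mod 6 = 0 \<and> b mod 5 = 3 \<longrightarrow>
         (if N \<le> (b - 5) * (b - 1) * (b + 1) \<and> b mod 7 \<noteq> 5
          then minimizes_last 4 \<rho> [b - 5, b - 1, b + 1, b + 2]
          else minimizes_last 4 \<rho> [b - 1, b + 1, b + 2, b + 3]))) \<and>
    (even b \<and> (b - 3) * (b - 1) * b < N \<and> N \<le> (b - 3) * (b - 1) * (b + 1) \<longrightarrow>
      (b mod 3 \<noteq> 1 \<and> b mod 5 \<noteq> 3 \<longrightarrow>
         minimizes_last 4 \<rho> [b - 3, b - 1, b + 1, b + 2]) \<and>
      (b mod 3 = 1 \<and> b mod 5 \<noteq> 3 \<longrightarrow> minimizes_last 4 \<rho> [b - 1, b, b + 1, b + 3]) \<and>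
      (b mod 5 = 3 \<longrightarrow>
         (b mod 3 \<noteq> 1 \<longrightarrow> minimizes_last 4 \<rho> [b - 1, b + 1, b + 2, b + 3]) \<and>
         (b mod 3 = 1 \<longrightarrow> minimizes_last 4 \<rho> [b - 1, b, b + 1, b + 3]))) \<and>
    (even b \<and> (b - 3) * (b - 1) * (b + 1) < N \<longrightarrow>
      (b mod 3 \<noteq> 0 \<and> b mod 5 \<noteq> 3 \<longrightarrow> minimizes_last 4 \<rho> [b - 1, b, b + 1, b + 3]) \<and>
      (b mod 3 = 0 \<or> (b mod 5 = 3 \<and> b mod 3 \<noteq> 1) \<longrightarrow>
         minimizes_last 4 \<rho> [b - 1, b + 1, b + 2, b + 3]) \<and>
      (b mod 5 = 3 \<and> b mod 3 = 1 \<longrightarrow> minimizes_last 4 \<rho> [b - 1, b, b + 1, b + 3]))"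
    (is "?A \<and> ?B \<and> ?C \<and> ?D")
proof (intro conjI)
  show ?A
    using minimal_A1 minimal_A2 assms by simp
next
  show ?B
  proof (intro impI conjI; (elim conjE)?)
    assume "even b" "N \<le> (b - 3) * (b - 1) * b" "b mod 6 \<in> {2, 4}"
    then show "minimizes_last 4 \<rho> [b - 3, b - 1, b, b + 1]"
      using minimal_B1 assms by simp
  next
    assume "even b" "N \<le> (b - 3) * (b - 1) * b" "b mod 6 = 0" "b mod 5 \<noteq> 3"
    moreover have "3 dvd b" "b mod 3 \<noteq> 1"
      using \<open>b mod 6 = 0\<close> by presburger+
    ultimately show "minimizes_last 4 \<rho> [b - 3, b - 1, b + 1, b + 2]"
      using minimal_minus3 small_imp assms by simp
  next
    assume b: "even b" "N \<le> (b - 3) * (b - 1) * b" "b mod 6 = 0" "b mod 5 = 3"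
    have b3: "3 dvd b" "b mod 3 = 0" "5 dvd b + 2"
      using \<open>b mod 6 = 0\<close> \<open>b mod 5 = 3\<close> by presburger+
    show "if N \<le> (b - 5) * (b - 1) * (b + 1) \<and> b mod 7 \<noteq> 5
          then minimizes_last 4 \<rho> [b - 5, b - 1, b + 1, b + 2]
          else minimizes_last 4 \<rho> [b - 1, b + 1, b + 2, b + 3]"
    proof (cases "N \<le> (b - 5) * (b - 1) * (b + 1) \<and> b mod 7 \<noteq> 5")
      case True
      then show ?thesis
        using minimal_B3_1[OF assms b(1) b3(2) b(4)] by simp
    next
      case False
      have "b mod 7 = 5 \<Longrightarrow> 7 dvd b + 2"
        by presburger
      with False have "(b - 5) * (b - 1) * (b + 1) < N \<or> 7 dvd b + 2"
        by linarith
      then have "b + 3 \<le> w" if "coprime_tuple 4 [x, y, z, w]" "N \<le> x * y * z" for x y z w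
        using last_ge_3_mod5[OF that b(1)] b3 by blast
      then show ?thesis
        unfolding if_not_P[OF False] using b3 by (intro minimal_plus3[OF assms b(1)]) auto
    qed
  qed
next
  have "minimizes_last 4 \<rho> [b - 3, b - 1, b + 1, b + 2]"
    if "even b" "(b - 3) * (b - 1) * b < N" "N \<le> (b - 3) * (b - 1) * (b + 1)"
      "b mod 3 \<noteq> 1" "b mod 5 \<noteq> 3"
    using that minimal_minus3 assms by blast
  moreover have "minimizes_last 4 \<rho> [b - 1, b, b + 1, b + 3]"
    if b: "even b" "(b - 3) * (b - 1) * b < N" "b mod 3 = 1"
  proof -
    have "3 dvd b + 2" "b mod 3 \<noteq> 0"
      using b(3) by presburger+
    then show ?thesis
      using b last_ge_3_mod3 by (intro minimal_plus3' assms) blast+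
  qed
  moreover have "minimizes_last 4 \<rho> [b - 1, b + 1, b + 2, b + 3]"
    if b: "even b" "(b - 3) * (b - 1) * b < N" "b mod 5 = 3" "b mod 3 \<noteq> 1"
  proof -
    have "5 dvd b + 2"
      using b(3) by presburger
    then show ?thesis
      using b medium_imp last_ge_3_mod5 by (intro minimal_plus3 assms) blast+
  qed
  ultimately show ?C
    by blast
next
  \<comment> \<open>Both candidates end in the least possible \<open>b + 3\<close>; the residue of
    \<open>b\<close> modulo 3 decides which are coprime, and for residue 2 both are.\<close>
  have "minimizes_last 4 \<rho> [b - 1, b, b + 1, b + 3]"
    if "even b" "(b - 3) * (b - 1) * (b + 1) < N" "b mod 3 \<noteq> 0"
    using that last_ge_3_large by (intro minimal_plus3' assms) blast+
  moreover have "minimizes_last 4 \<rho> [b - 1, b + 1, b + 2, b + 3]"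
    if "even b" "(b - 3) * (b - 1) * (b + 1) < N" "b mod 3 \<noteq> 1"
    using that last_ge_3_large by (intro minimal_plus3 assms) blast+
  ultimately show ?D
    by (metis zero_neq_one)
qed

end

section \<open>Pairs, triples and the small cases\<close>

lemma minimal_pair:
  assumes "1 < \<rho>"
  shows "minimizes_last 2 \<rho> [\<lceil>\<rho>\<rceil>, \<lceil>\<rho>\<rceil> + 1]"
proof (rule minimizes_last_2I)
  have "1 < \<lceil>\<rho>\<rceil>"
    using assms by (simp add: less_ceiling_iff)
  then show "coprime_tuple 2 [\<lceil>\<rho>\<rceil>, \<lceil>\<rho>\<rceil> + 1]"
    unfolding coprime_tuple_2 by (intro conjI coprime_near) simp_all
qed (auto simp: coprime_tuple_2)

text \<open>For odd \<open>b\<close> a last entry \<open>b + 1\<close> is even and leaves odd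
  numbers only, the best pair being \<open>b - 2\<close> and \<open>b\<close>. This pair fails if
  its product is too small or if 3 divides \<open>b + 1\<close> and hence
  \<open>b - 2\<close>.\<close>

lemma minimal_triple:
  assumes "4 \<le> b" and below: "(b - 2) * (b - 1) < \<lceil>\<rho>\<rceil>" and within: "\<lceil>\<rho>\<rceil> \<le> b * (b - 1)"
  shows "if even b then minimizes_last 3 \<rho> [b - 1, b, b + 1]
    else if 5 \<le> b \<and> \<lceil>\<rho>\<rceil> \<le> (b - 2) * b \<and> (b + 1) mod 3 \<noteq> 0
    then minimizes_last 3 \<rho> [b - 2, b, b + 1]
    else minimizes_last 3 \<rho> [b, b + 1, b + 2]"
proof -
  have prod_le: "x * y \<le> A * B" if "coprime_tuple 3 [x, y, z]" "x \<le> A" "y \<le> B" for x y z A B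
    using that by (intro mult_mono) (auto simp: coprime_tuple_3)
  have ge_1: "b + 1 \<le> z" if t: "coprime_tuple 3 [x, y, z]" and N: "\<lceil>\<rho>\<rceil> \<le> x * y" for x y z
  proof (rule ccontr)
    assume "\<not> b + 1 \<le> z"
    then have "x \<le> b - 2" "y \<le> b - 1"
      using t by (auto simp: coprime_tuple_3)
    then show False
      using prod_le[OF t, of "b - 2" "b - 1"] N below by linarith
  qed
  have prod_1: "\<lceil>\<rho>\<rceil> \<le> (b - 1) * b" and prod_2: "\<lceil>\<rho>\<rceil> \<le> b * (b + 1)"
    using within \<open>4 \<le> b\<close> by (simp_all only: algebra_simps)
  show ?thesis
  proof (cases "even b")
    case True
    have "minimizes_last 3 \<rho> [b - 1, b, b + 1]"
    proof (rule minimizes_last_3I[OF _ prod_1 ge_1])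
      show "coprime_tuple 3 [b - 1, b, b + 1]"
        unfolding coprime_tuple_3 using True \<open>4 \<le> b\<close>
        by (intro conjI coprime_near) presburger+
    qed
    then show ?thesis
      using True by simp
  next
    case False
    then have "5 \<le> b"
      using \<open>4 \<le> b\<close> by presburger
    show ?thesis
    proof (cases "\<lceil>\<rho>\<rceil> \<le> (b - 2) * b \<and> (b + 1) mod 3 \<noteq> 0")
      case inner: True
      have "minimizes_last 3 \<rho> [b - 2, b, b + 1]"
      proof (rule minimizes_last_3I[OF _ _ ge_1])
        show "coprime_tuple 3 [b - 2, b, b + 1]"
          unfolding coprime_tuple_3 using False inner \<open>5 \<le> b\<close>
          by (intro conjI coprime_near) presburger+
      qed (use inner in auto)
      then show ?thesis
        using False inner \<open>5 \<le> b\<close> by simp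
    next
      case inner: False
      have "minimizes_last 3 \<rho> [b, b + 1, b + 2]"
      proof (rule minimizes_last_3I[OF _ prod_2])
        show "coprime_tuple 3 [b, b + 1, b + 2]"
          unfolding coprime_tuple_3 using False \<open>5 \<le> b\<close>
          by (intro conjI coprime_near) presburger+
        show "b + 2 \<le> z" if t: "coprime_tuple 3 [x, y, z]" and N: "\<lceil>\<rho>\<rceil> \<le> x * y" for x y z
        proof -
          have "z \<noteq> b + 1"
          proof
            assume z: "z = b + 1"
            have ord: "x < y" "y < z"
              using t by (simp_all add: coprime_tuple_3)
            have "odd x" "odd y"
              using t z False not_both_dvd[of x z 2] not_both_dvd[of y z 2]
              by (auto simp: coprime_tuple_3)
            then have y: "y \<le> b" and x: "x \<le> b - 2"
              using ord z False by presburger+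
            \<comment> \<open>The product condition thus holds, so \<open>inner\<close> must fail
              through the residue modulo 3.\<close>
            have "\<lceil>\<rho>\<rceil> \<le> (b - 2) * b"
              using prod_le[OF t x y] N by linarith
            then have "3 dvd z"
              using inner z by (simp add: dvd_eq_mod_eq_0)
            then have "\<not> 3 dvd x"
              using t not_both_dvd[of x z 3] by (auto simp: coprime_tuple_3)
            then have "x \<noteq> b - 2"
              using \<open>3 dvd z\<close> z by presburger
            then have "x \<le> b - 4"
              using x \<open>odd x\<close> False by presburger
            \<comment> \<open>This is \<open>b + 2\<close> less than
              \<open>(b - 2) * (b - 1)\<close>, against the minimality of \<open>b\<close>.\<close>
            then have "\<lceil>\<rho>\<rceil> \<le> (b - 4) * b"
              using prod_le[OF t _ y] N by fastforce
            then show False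
              using below \<open>5 \<le> b\<close> by (simp only: algebra_simps)
          qed
          then show ?thesis
            using ge_1[OF t N] by linarith
        qed
      qed
      then show ?thesis
        using False inner by (simp only: if_False simp_thms)
    qed
  qed
qed

lemma coprime_triple_last_ge_5:
  assumes "coprime_tuple 3 [x, y, z]"
  shows "5 \<le> z"
proof (rule ccontr)
  assume "\<not> 5 \<le> z"
  then have "x = 2" "z = 4"
    using assms by (auto simp: coprime_tuple_3)
  then show False
    using assms by (simp add: coprime_tuple_3)
qed

lemma coprime_triple_last_5:
  assumes t: "coprime_tuple 3 [x, y, 5]" and "[x, y, 5] \<noteq> [2, 3, 5]"
  shows "30 < x * y * 5"
proof -
  have "x \<in> {2..3}" "y \<in> {3..4}" "x < y" "odd x \<or> odd y"
    using t not_both_dvd[of x y 2] by (auto simp: coprime_tuple_3)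
  then have "x = 3 \<and> y = 4"
    using assms(2) by auto presburger+
  then show ?thesis
    by simp
qed

text \<open>An even last entry up to 6 would force \<open>x \<le> 1\<close>, and a last entry 5
  leaves only 2, 3, 4 for the others.\<close>

lemma coprime_quadruple_last_ge_7:
  assumes t: "coprime_tuple 4 [x, y, z, w]"
  shows "7 \<le> w"
proof (rule ccontr)
  assume "\<not> 7 \<le> w"
  note ord = coprime_tuple_4_order[OF t]
  have "odd w"
    using even_last_odd(4)[OF t] ord(1) \<open>\<not> 7 \<le> w\<close> by linarith
  then have "w = 5"
    using ord \<open>\<not> 7 \<le> w\<close> by presburger
  then have "x = 2" "z = 4"
    using ord by linarith+
  then show False
    using coprime_tuple_4_parity(2)[OF t] by simp
qed

lemma coprime_quadruple_last_7:
  assumes t: "coprime_tuple 4 [x, y, z, 7]" and "[x, y, z, 7] \<noteq> [2, 3, 5, 7]"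
  shows "210 < x * y * z * 7"
proof -
  note ord = coprime_tuple_4_order[OF t] and par = coprime_tuple_4_parity[OF t]
  have x: "x = 2 \<or> x = 3 \<or> x = 4" and y: "y = 3 \<or> y = 4 \<or> y = 5" and z: "z = 4 \<or> z = 5 \<or> z = 6"
    using ord by presburger+
  show ?thesis
    using x y z ord par assms(2) by (elim disjE) simp_all
qed

text \<open>The list \<open>[3, 4, 5]\<close> attains the same last entry, so minimality alone does
  not single out \<open>[2, 3, 5]\<close>; the strictly smaller total product does. For quadruples
  the competitor is \<open>[3, 4, 5, 7]\<close>.\<close>

lemma minimal_triple_small:
  assumes "\<rho> \<le> 6"
  shows "minimizes_last 3 \<rho> [2, 3, 5]"
    and "minimizes_last 3 \<rho> G \<Longrightarrow> G \<noteq> [2, 3, 5] \<Longrightarrow> prod_list [2, 3, 5] < prod_list G"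
proof -
  have tuple: "coprime_tuple 3 [2, 3, 5]"
    unfolding coprime_tuple_3 by (intro conjI coprime_near) simp_all
  show min: "minimizes_last 3 \<rho> [2, 3, 5]"
    using assms tuple coprime_triple_last_ge_5
    by (intro minimizes_last_3I) (auto simp: ceiling_le_iff)
  assume G: "minimizes_last 3 \<rho> G" "G \<noteq> [2, 3, 5]"
  then have "coprime_tuple 3 G"
    by (simp add: minimizes_last_def is_arg_min_def)
  then obtain x y z where xyz: "G = [x, y, z]" and t: "coprime_tuple 3 [x, y, z]"
    using coprime_tuple_3E by metis
  have "\<not> last [2, 3, 5] < last G"
    using G(1) min unfolding minimizes_last_def is_arg_min_def by blast
  then have "z = 5"
    using coprime_triple_last_ge_5[OF t] xyz by simp
  then show "prod_list [2, 3, 5] < prod_list G"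
    using coprime_triple_last_5[of x y] t G(2) xyz by simp
qed

lemma minimal_quartet_small:
  assumes "\<rho> \<le> 30"
  shows "minimizes_last 4 \<rho> [2, 3, 5, 7]"
    and "minimizes_last 4 \<rho> G \<Longrightarrow> G \<noteq> [2, 3, 5, 7] \<Longrightarrow> prod_list [2, 3, 5, 7] < prod_list G"
proof -
  have tuple: "coprime_tuple 4 [2, 3, 5, 7]"
    unfolding coprime_tuple_4 by (intro conjI coprime_near) simp_all
  show min: "minimizes_last 4 \<rho> [2, 3, 5, 7]"
    using assms tuple coprime_quadruple_last_ge_7
    by (intro minimizes_last_4I) (auto simp: ceiling_le_iff)
  assume G: "minimizes_last 4 \<rho> G" "G \<noteq> [2, 3, 5, 7]"
  then have "coprime_tuple 4 G"
    by (simp add: minimizes_last_def is_arg_min_def)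
  then obtain x y z w where xyzw: "G = [x, y, z, w]" and t: "coprime_tuple 4 [x, y, z, w]"
    using coprime_tuple_4E by metis
  have "\<not> last [2, 3, 5, 7] < last G"
    using G(1) min unfolding minimizes_last_def is_arg_min_def by blast
  then have "w = 7"
    using coprime_quadruple_last_ge_7[OF t] xyzw by simp
  then show "prod_list [2, 3, 5, 7] < prod_list G"
    using coprime_quadruple_last_7[of x y z] t G(2) xyzw by (simp add: mult.assoc)
qed

section \<open>Existence and minimality of the width \<open>b\<close>\<close>

text \<open>The integers are not well-ordered, so the lower bound \<open>c\<close> is used to shift
  the problem to natural numbers.\<close>

lemma Least_int:
  fixes P :: "int \<Rightarrow> bool"
  assumes "P m" and bound: "\<And>n. P n \<Longrightarrow> c \<le> n"
  shows "P (LEAST n. P n)" and "\<not> P ((LEAST n. P n) - 1)"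
proof -
  define k where "k = (LEAST k. P (c + int k))"
  have "P (c + int (nat (m - c)))"
    using assms by simp
  then have k: "P (c + int k)"
    unfolding k_def by (rule LeastI)
  have min: "c + int k \<le> n" if "P n" for n
  proof -
    have "P (c + int (nat (n - c)))"
      using that bound[OF that] by simp
    then have "k \<le> nat (n - c)"
      unfolding k_def by (rule Least_le)
    then show ?thesis
      using bound[OF that] by linarith
  qed
  have eq: "(LEAST n. P n) = c + int k"
    using k min by (rule Least_equality)
  show "P (LEAST n. P n)"
    using k eq by simp
  show "\<not> P ((LEAST n. P n) - 1)"
    using min[of "c + int k - 1"] eq by auto
qed

lemma triple_width:
  assumes "6 < N"
  defines "b \<equiv> LEAST n::int. 3 \<le> n \<and> N \<le> n * (n - 1)"
  shows "4 \<le> b" "(b - 2) * (b - 1) < N" "N \<le> b * (b - 1)"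
proof -
  \<comment> \<open>The number \<open>N\<close> itself witnesses that a candidate for
    \<open>b\<close> exists.\<close>
  have "N * 1 \<le> N * (N - 1)"
    using assms(1) by (intro mult_left_mono) auto
  then have ex: "3 \<le> N \<and> N \<le> N * (N - 1)"
    using assms(1) by simp
  note least = Least_int[of "\<lambda>n. 3 \<le> n \<and> N \<le> n * (n - 1)", OF ex, of 3, folded b_def]
  show "N \<le> b * (b - 1)"
    using least(1) by simp
  \<comment> \<open>At 3 the product is only 6. Hence \<open>b - 1\<close> is still in the range
    from 3 on, and it can fail only through its product.\<close>
  have "b \<noteq> 3"
    using least(1) assms(1) by auto
  then show "4 \<le> b"
    using least(1) by simp
  then show "(b - 2) * (b - 1) < N"
    using least(2) by (auto simp: mult.commute)
qed

lemma quartet_width_Least: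
  assumes "30 < N"
  defines "b \<equiv> LEAST n::int. 5 \<le> n \<and> N \<le> n * (n - 1) * (n - 2)"
  shows "quartet_width N b"
proof
  have "N * 1 * 1 \<le> N * (N - 1) * (N - 2)"
    using assms(1) by (intro mult_mono) auto
  then have ex: "5 \<le> N \<and> N \<le> N * (N - 1) * (N - 2)"
    using assms(1) by simp
  note least = Least_int[of "\<lambda>n. 5 \<le> n \<and> N \<le> n * (n - 1) * (n - 2)", OF ex, of 5, folded b_def]
  show "5 \<le> b" "N \<le> b * (b - 1) * (b - 2)"
    using least(1) by simp_all
  show "(b - 3) * (b - 2) * (b - 1) < N"
  \<comment> \<open>Minimality says nothing about 4, which lies outside the range of candidates;
    there the claim is \<open>24 < N\<close>.\<close>
  proof (cases "b = 5")
    case True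
    then show ?thesis
      using assms(1) by simp
  next
    case False
    then show ?thesis
      using least \<open>5 \<le> b\<close> by (auto simp: mult_ac)
  qed
qed

section \<open>Assembly of the cases for all three lengths\<close>

theorem theorem1:
  fixes m_max N_th \<rho> :: real
  assumes "0 < m_max" and "0 < N_th" and "\<rho> = N_th / m_max" and "1 < \<rho>"
  shows
    "(\<forall>L\<in>{2, 3, 4}. \<forall>G. optimal L m_max N_th G \<longleftrightarrow> minimizes_last L \<rho> G) \<and>

     optimal 2 m_max N_th [\<lceil>\<rho>\<rceil>, \<lceil>\<rho>\<rceil> + 1] \<and>

     (\<rho> \<le> 6 \<longrightarrow>
        optimal 3 m_max N_th [2, 3, 5] \<and>
        (\<forall>G. optimal 3 m_max N_th G \<and> G \<noteq> [2, 3, 5] \<longrightarrow> prod_list [2, 3, 5] < prod_list G)) \<and>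
     (6 < \<rho> \<longrightarrow>
        (let b = (LEAST n::int. 3 \<le> n \<and> \<rho> \<le> of_int (n * (n - 1))) in
          if even b then optimal 3 m_max N_th [b - 1, b, b + 1]
          else if 5 \<le> b \<and> \<rho> \<le> of_int ((b - 2) * b) \<and> (b + 1) mod 3 \<noteq> 0
            then optimal 3 m_max N_th [b - 2, b, b + 1]
          else optimal 3 m_max N_th [b, b + 1, b + 2])) \<and>

     (\<rho> \<le> 30 \<longrightarrow>
        optimal 4 m_max N_th [2, 3, 5, 7] \<and>
        (\<forall>G. optimal 4 m_max N_th G \<and> G \<noteq> [2, 3, 5, 7] \<longrightarrow>
           prod_list [2, 3, 5, 7] < prod_list G)) \<and>
     (30 < \<rho> \<longrightarrow>
        (let b = (LEAST n::int. 5 \<le> n \<and> \<rho> \<le> of_int (n * (n - 1) * (n - 2))) in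
          (odd b \<longrightarrow>
             (b mod 3 \<noteq> 1 \<longrightarrow> optimal 4 m_max N_th [b - 2, b - 1, b, b + 2]) \<and>
             (b mod 3 = 1 \<longrightarrow> optimal 4 m_max N_th [b - 2, b, b + 1, b + 2])) \<and>
          (even b \<and> \<rho> \<le> of_int ((b - 3) * (b - 1) * b) \<longrightarrow>
             (b mod 6 \<in> {2, 4} \<longrightarrow> optimal 4 m_max N_th [b - 3, b - 1, b, b + 1]) \<and>
             (b mod 6 = 0 \<and> b mod 5 \<noteq> 3 \<longrightarrow>
                optimal 4 m_max N_th [b - 3, b - 1, b + 1, b + 2]) \<and>
             (b mod 6 = 0 \<and> b mod 5 = 3 \<longrightarrow>
                (if \<rho> \<le> of_int ((b - 5) * (b - 1) * (b + 1)) \<and> b mod 7 \<noteq> 5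
                 then optimal 4 m_max N_th [b - 5, b - 1, b + 1, b + 2]
                 else optimal 4 m_max N_th [b - 1, b + 1, b + 2, b + 3]))) \<and>
          (even b \<and> of_int ((b - 3) * (b - 1) * b) < \<rho> \<and>
             \<rho> \<le> of_int ((b - 3) * (b - 1) * (b + 1)) \<longrightarrow>
             (b mod 3 \<noteq> 1 \<and> b mod 5 \<noteq> 3 \<longrightarrow>
                optimal 4 m_max N_th [b - 3, b - 1, b + 1, b + 2]) \<and>
             (b mod 3 = 1 \<and> b mod 5 \<noteq> 3 \<longrightarrow>
                optimal 4 m_max N_th [b - 1, b, b + 1, b + 3]) \<and>
             (b mod 5 = 3 \<longrightarrow>
                (b mod 3 \<noteq> 1 \<longrightarrow> optimal 4 m_max N_th [b - 1, b + 1, b + 2, b + 3]) \<and>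
                (b mod 3 = 1 \<longrightarrow> optimal 4 m_max N_th [b - 1, b, b + 1, b + 3]))) \<and>
          (even b \<and> of_int ((b - 3) * (b - 1) * (b + 1)) < \<rho> \<longrightarrow>
             (b mod 3 \<noteq> 0 \<and> b mod 5 \<noteq> 3 \<longrightarrow>
                optimal 4 m_max N_th [b - 1, b, b + 1, b + 3]) \<and>
             (b mod 3 = 0 \<or> (b mod 5 = 3 \<and> b mod 3 \<noteq> 1) \<longrightarrow>
                optimal 4 m_max N_th [b - 1, b + 1, b + 2, b + 3]) \<and>
             (b mod 5 = 3 \<and> b mod 3 = 1 \<longrightarrow>
                optimal 4 m_max N_th [b - 1, b, b + 1, b + 3]))))"
proof -
  have opt: "optimal L m_max N_th G \<longleftrightarrow> minimizes_last L \<rho> G" if "0 < L" for L G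
    using assms that by (intro optimal_iff_minimizes_last)
  have 6: "\<rho> \<le> 6 \<Longrightarrow> minimizes_last 3 \<rho> [2, 3, 5] \<and>
      (\<forall>G. minimizes_last 3 \<rho> G \<and> G \<noteq> [2, 3, 5] \<longrightarrow> prod_list [2, 3, 5] < prod_list G)"
    and 30: "\<rho> \<le> 30 \<Longrightarrow> minimizes_last 4 \<rho> [2, 3, 5, 7] \<and>
      (\<forall>G. minimizes_last 4 \<rho> G \<and> G \<noteq> [2, 3, 5, 7] \<longrightarrow> prod_list [2, 3, 5, 7] < prod_list G)"
    using minimal_triple_small minimal_quartet_small by blast+
  have gt: "6 < \<rho> \<Longrightarrow> 6 < \<lceil>\<rho>\<rceil>" "30 < \<rho> \<Longrightarrow> 30 < \<lceil>\<rho>\<rceil>"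
    by (simp_all add: less_ceiling_iff)
  have triple: "6 < \<rho> \<Longrightarrow> let b = LEAST n. 3 \<le> n \<and> \<lceil>\<rho>\<rceil> \<le> n * (n - 1) in
      if even b then minimizes_last 3 \<rho> [b - 1, b, b + 1]
      else if 5 \<le> b \<and> \<lceil>\<rho>\<rceil> \<le> (b - 2) * b \<and> (b + 1) mod 3 \<noteq> 0
        then minimizes_last 3 \<rho> [b - 2, b, b + 1]
      else minimizes_last 3 \<rho> [b, b + 1, b + 2]"
    unfolding Let_def by (rule minimal_triple[OF triple_width[OF gt(1)]])
  have all: "\<forall>L\<in>{2, 3, 4}. \<forall>G. optimal L m_max N_th G \<longleftrightarrow> minimizes_last L \<rho> G"
    using opt by simp
  show ?thesis
    apply (rule conjI[OF all])
    \<comment> \<open>Comparisons of \<open>\<rho>\<close> with integers become comparisons with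
      \<open>\<lceil>\<rho>\<rceil>\<close>, also under \<open>LEAST\<close>, so that
      \<open>b\<close> takes literally the form used in the integer lemmas.\<close>
    unfolding opt[of 2, simplified] opt[of 3, simplified] opt[of 4, simplified]
      ceiling_le_iff[symmetric] less_ceiling_iff[symmetric]
    apply (intro conjI[OF minimal_pair[OF assms(4)]] conjI[OF impI[OF 6]] conjI[OF impI[OF triple]]
        conjI[OF impI[OF 30]] impI; assumption?)
    unfolding Let_def
    by (rule quartet_width.minimal_quartet[OF quartet_width_Least[OF gt(2)] refl])
qed

end
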